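(* Let $E$ be a (real or complex) Banach space. Suppose that $E$ has a Besselian Schauder frame and $E^{**}$ is separable. Then $E$ is reflexive.
   Context: A Besselian Schauder frame for a Banach space $E$ is a sequence $((a_n,b_n^* ))_{n\ge1}$ in $E\times E^*$ such that (i) for every $x\in E$ the series $\sum_n b_n^*(x)a_n$ converges in norm to $x$, and (ii) there is $B>0$ with $\sum_{n=1}^\infty|b_n^*(x)||y^*(a_n)|\le B\|x\|_E\|y^*\|_{E^*}$ for all $x\in E$, $y^*\in E^*$. *)

theory Defs
  imports "HOL-Analysis.Analysis"
begin

section \<open>Complex normed spaces and their duals\<close>

text \<open>
  The distribution only has real normed spaces. A complex normed space is a real one with a
  compatible action of the complex numbers.
\<close>

class complex_normed_vector = real_normed_vector +
  fixes scaleC :: "complex \<Rightarrow> 'a \<Rightarrow> 'a"  (infixr \<open>*\<^sub>C\<close> 75)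
  assumes scaleC_add_right: "c *\<^sub>C (x + y) = c *\<^sub>C x + c *\<^sub>C y"
    and scaleC_add_left: "(c + d) *\<^sub>C x = c *\<^sub>C x + d *\<^sub>C x"
    and scaleC_scaleC: "c *\<^sub>C d *\<^sub>C x = (c * d) *\<^sub>C x"
    and scaleC_of_real: "complex_of_real r *\<^sub>C x = r *\<^sub>R x"
    and norm_scaleC: "norm (c *\<^sub>C x) = cmod c * norm x"

class cbanach = complex_normed_vector + banach

text \<open>
  The dual of a complex normed space: the bounded complex-linear functionals, as a subspace of the
  bounded real-linear maps into the complex numbers, with the inherited operator norm.
\<close>

typedef (overloaded) 'a cdual =
  "{f :: 'a::complex_normed_vector \<Rightarrow>\<^sub>L complex. \<forall>c x. f (c *\<^sub>C x) = c * f x}"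
  morphisms blinfun_of_cdual Abs_cdual
  by (rule exI[of _ 0]) simp

setup_lifting type_definition_cdual

lift_definition cdual_apply :: "'a::complex_normed_vector cdual \<Rightarrow> 'a \<Rightarrow> complex"
  is blinfun_apply .

lemma cdual_apply_scaleC: "cdual_apply f (c *\<^sub>C x) = c * cdual_apply f x"
  by transfer simp

lemma bounded_linear_cdual_apply: "bounded_linear (cdual_apply f)"
  by transfer (rule blinfun.bounded_linear_right)

instantiation cdual :: (complex_normed_vector) complex_normed_vector
begin

lift_definition zero_cdual :: "'a cdual" is 0
  by simp

lift_definition plus_cdual :: "'a cdual \<Rightarrow> 'a cdual \<Rightarrow> 'a cdual" is "(+)"
  by (simp add: blinfun.add_left distrib_left)

lift_definition minus_cdual :: "'a cdual \<Rightarrow> 'a cdual \<Rightarrow> 'a cdual" is "(-)"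
  by (simp add: blinfun.diff_left right_diff_distrib)

lift_definition uminus_cdual :: "'a cdual \<Rightarrow> 'a cdual" is uminus
  by (simp add: blinfun.minus_left)

lift_definition scaleR_cdual :: "real \<Rightarrow> 'a cdual \<Rightarrow> 'a cdual" is "(*\<^sub>R)"
  by (simp add: blinfun.scaleR_left)

lift_definition scaleC_cdual :: "complex \<Rightarrow> 'a cdual \<Rightarrow> 'a cdual"
  is "\<lambda>c f. blinfun_mult_right c o\<^sub>L f"
  by simp

lift_definition norm_cdual :: "'a cdual \<Rightarrow> real" is norm .

definition sgn_cdual :: "'a cdual \<Rightarrow> 'a cdual"
  where "sgn_cdual f = scaleR (inverse (norm f)) f"

definition dist_cdual :: "'a cdual \<Rightarrow> 'a cdual \<Rightarrow> real"
  where "dist_cdual f g = norm (f - g)"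

definition [code del]:
  "(uniformity :: ('a cdual \<times> 'a cdual) filter) = (INF e\<in>{0 <..}. principal {(f, g). dist f g < e})"

definition open_cdual :: "'a cdual set \<Rightarrow> bool"
  where [code del]: "open_cdual S = (\<forall>f\<in>S. \<forall>\<^sub>F (f', g) in uniformity. f' = f \<longrightarrow> g \<in> S)"

instance
proof
  fix f g h :: "'a cdual" and r s :: real and c d :: complex and S :: "'a cdual set"
  show "f + g + h = f + (g + h)" by transfer (simp add: add.assoc)
  show "f + g = g + f" by transfer (simp add: add.commute)
  show "0 + f = f" by transfer simp
  show "- f + f = 0" by transfer simp
  show "f - g = f + - g" by transfer simp
  show "r *\<^sub>R (f + g) = r *\<^sub>R f + r *\<^sub>R g" by transfer (simp add: scaleR_add_right)
  show "(r + s) *\<^sub>R f = r *\<^sub>R f + s *\<^sub>R f" by transfer (simp add: scaleR_add_left)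
  show "r *\<^sub>R s *\<^sub>R f = (r * s) *\<^sub>R f" by transfer simp
  show "1 *\<^sub>R f = f" by transfer simp
  show "sgn f = inverse (norm f) *\<^sub>R f" by (rule sgn_cdual_def)
  show "dist f g = norm (f - g)" by (rule dist_cdual_def)
  show "(uniformity :: ('a cdual \<times> 'a cdual) filter) =
      (INF e\<in>{0 <..}. principal {(f, g). dist f g < e})"
    by (rule uniformity_cdual_def)
  show "open S = (\<forall>f\<in>S. \<forall>\<^sub>F (f', g) in uniformity. f' = f \<longrightarrow> g \<in> S)"
    by (rule open_cdual_def)
  show "(norm f = 0) = (f = 0)" by transfer simp
  show "norm (f + g) \<le> norm f + norm g" by transfer (rule norm_triangle_ineq)
  show "norm (r *\<^sub>R f) = \<bar>r\<bar> * norm f" by transfer simp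
  show "c *\<^sub>C (f + g) = c *\<^sub>C f + c *\<^sub>C g"
    by transfer (auto intro!: blinfun_eqI simp: blinfun.add_left distrib_left)
  show "(c + d) *\<^sub>C f = c *\<^sub>C f + d *\<^sub>C f"
    by transfer (auto intro!: blinfun_eqI simp: blinfun.add_left distrib_right)
  show "c *\<^sub>C d *\<^sub>C f = (c * d) *\<^sub>C f"
    by transfer (auto intro!: blinfun_eqI simp: mult.assoc)
  show "complex_of_real r *\<^sub>C f = r *\<^sub>R f"
    by transfer (auto intro!: blinfun_eqI simp: blinfun.scaleR_left scaleR_conv_of_real)
  show "norm (c *\<^sub>C f) = cmod c * norm f"
  proof transfer
    fix c and f :: "'a \<Rightarrow>\<^sub>L complex"
    have le: "norm (blinfun_mult_right e o\<^sub>L g) \<le> cmod e * norm g"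
      for e and g :: "'a \<Rightarrow>\<^sub>L complex"
    proof (rule norm_blinfun_bound)
      fix x
      have "norm ((blinfun_mult_right e o\<^sub>L g) x) = cmod e * cmod (g x)"
        by (simp add: norm_mult)
      also have "\<dots> \<le> cmod e * (norm g * norm x)"
        by (intro mult_left_mono norm_blinfun) simp
      finally show "norm ((blinfun_mult_right e o\<^sub>L g) x) \<le> cmod e * norm g * norm x"
        by (simp add: mult.assoc)
    qed simp
    show "norm (blinfun_mult_right c o\<^sub>L f) = cmod c * norm f"
    proof (cases "c = 0")
      case True
      then show ?thesis using le[of c f] by simp
    next
      case False
      have "blinfun_mult_right (inverse c) o\<^sub>L (blinfun_mult_right c o\<^sub>L f) = f"
        using False by (intro blinfun_eqI) simp
      then have "norm f \<le> inverse (cmod c) * norm (blinfun_mult_right c o\<^sub>L f)"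
        using le[of "inverse c" "blinfun_mult_right c o\<^sub>L f"] by (simp add: norm_inverse)
      then have "cmod c * norm f \<le> norm (blinfun_mult_right c o\<^sub>L f)"
        using False by (simp add: field_simps)
      then show ?thesis using le[of c f] by simp
    qed
  qed
qed

end

section \<open>Reflexivity\<close>

lift_definition canonical_embedding ::
  "'a::real_normed_vector \<Rightarrow> ('a \<Rightarrow>\<^sub>L real) \<Rightarrow>\<^sub>L real" is "\<lambda>x f. blinfun_apply f x"
  by (rule blinfun.bounded_linear_left)

definition reflexive_space :: "'a::real_normed_vector itself \<Rightarrow> bool" where
  "reflexive_space _ \<longleftrightarrow> surj (canonical_embedding :: 'a \<Rightarrow> ('a \<Rightarrow>\<^sub>L real) \<Rightarrow>\<^sub>L real)"

lemma bounded_linear_cdual_eval: "bounded_linear (\<lambda>f. cdual_apply f x)"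
proof (rule bounded_linear_intro)
  show "cdual_apply (f + g) x = cdual_apply f x + cdual_apply g x" for f g
    by transfer (rule blinfun.add_left)
  show "cdual_apply (r *\<^sub>R f) x = r *\<^sub>R cdual_apply f x" for r f
    by transfer (rule blinfun.scaleR_left)
  show "norm (cdual_apply f x) \<le> norm f * norm x" for f
    by transfer (rule norm_blinfun)
qed

lift_definition blinfun_cdual_eval ::
  "'a::complex_normed_vector \<Rightarrow> 'a cdual \<Rightarrow>\<^sub>L complex" is "\<lambda>x f. cdual_apply f x"
  by (rule bounded_linear_cdual_eval)

lemma cdual_apply_scaleC_left: "cdual_apply (c *\<^sub>C f) x = c * cdual_apply f x"
  by transfer simp

lift_definition complex_canonical_embedding ::
  "'a::complex_normed_vector \<Rightarrow> 'a cdual cdual" is blinfun_cdual_eval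
  by (simp add: blinfun_cdual_eval.rep_eq cdual_apply_scaleC_left)

lemma complex_canonical_embedding_apply:
  "cdual_apply (complex_canonical_embedding x) f = cdual_apply f x"
  by (simp add: cdual_apply.rep_eq complex_canonical_embedding.rep_eq blinfun_cdual_eval.rep_eq)

definition complex_reflexive_space :: "'a::complex_normed_vector itself \<Rightarrow> bool" where
  "complex_reflexive_space _ \<longleftrightarrow> surj (complex_canonical_embedding :: 'a \<Rightarrow> 'a cdual cdual)"

section \<open>Besselian Schauder frames\<close>

text \<open>Summability is stated separately because \<^const>\<open>suminf\<close> is unspecified on divergent series.\<close>

definition besselian_schauder_frame ::
  "(nat \<Rightarrow> 'a::real_normed_vector \<times> ('a \<Rightarrow>\<^sub>L real)) \<Rightarrow> bool" where
  "besselian_schauder_frame F \<longleftrightarrow>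
    (\<forall>x. (\<lambda>n. blinfun_apply (snd (F n)) x *\<^sub>R fst (F n)) sums x) \<and>
    (\<exists>B>0. \<forall>x (y :: 'a \<Rightarrow>\<^sub>L real).
      summable (\<lambda>n. \<bar>blinfun_apply (snd (F n)) x\<bar> * \<bar>blinfun_apply y (fst (F n))\<bar>) \<and>
      (\<Sum>n. \<bar>blinfun_apply (snd (F n)) x\<bar> * \<bar>blinfun_apply y (fst (F n))\<bar>) \<le> B * norm x * norm y)"

definition complex_besselian_schauder_frame ::
  "(nat \<Rightarrow> 'a::complex_normed_vector \<times> 'a cdual) \<Rightarrow> bool" where
  "complex_besselian_schauder_frame F \<longleftrightarrow>
    (\<forall>x. (\<lambda>n. cdual_apply (snd (F n)) x *\<^sub>C fst (F n)) sums x) \<and>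
    (\<exists>B>0. \<forall>x (y :: 'a cdual).
      summable (\<lambda>n. cmod (cdual_apply (snd (F n)) x) * cmod (cdual_apply y (fst (F n)))) \<and>
      (\<Sum>n. cmod (cdual_apply (snd (F n)) x) * cmod (cdual_apply y (fst (F n)))) \<le> B * norm x * norm y)"

end

theory Submission
  imports Defs
begin

text \<open>
  The engine is a Baire category argument: if the dual of \<open>X\<close> is separable, then every series in it
  with \<open>\<Sum>|f\<^sub>n(x)| \<le> K \<parallel>x\<parallel>\<close> for all \<open>x\<close> converges in norm. Let \<open>(a\<^sub>n, b\<^sub>n)\<close> be the frame of \<open>E\<close>,
  \<open>\<phi>\<close> a bidual functional and \<open>y\<close> a functional. For \<open>X = E\<close> the series \<open>\<Sum> y(a\<^sub>n) b\<^sub>n\<close> converges in norm,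
  necessarily to \<open>y\<close>; for \<open>X\<close> the dual of \<open>E\<close> the series \<open>\<Sum> \<phi>(b\<^sub>n) a\<^sub>n\<close> converges in norm, to some
  \<open>z\<close>. Hence \<open>\<phi>(y) = \<Sum> y(a\<^sub>n) \<phi>(b\<^sub>n) = y(z)\<close>, so \<open>\<phi>\<close> is evaluation at \<open>z\<close>. A complex space is treated
  through its underlying real space.
\<close>

section \<open>The Hahn--Banach theorem\<close>

definition sublinear :: "('a::real_vector \<Rightarrow> real) \<Rightarrow> bool" where
  "sublinear p \<longleftrightarrow> (\<forall>x y. p (x + y) \<le> p x + p y) \<and> (\<forall>c\<ge>0. \<forall>x. p (c *\<^sub>R x) = c * p x)"

lemma sublinear_add: "sublinear p \<Longrightarrow> p (x + y) \<le> p x + p y"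
  and sublinear_scaleR: "sublinear p \<Longrightarrow> 0 \<le> c \<Longrightarrow> p (c *\<^sub>R x) = c * p x"
  by (auto simp: sublinear_def)

lemma sublinear_zero: "sublinear p \<Longrightarrow> p 0 = 0"
  using sublinear_scaleR[of p 0 0] by simp

lemma sublinear_lower: "sublinear p \<Longrightarrow> - p (- x) \<le> p x"
  using sublinear_add[of p x "- x"] by (simp add: sublinear_zero)

text \<open>Applying the scaling inequality with \<open>inverse c\<close> at
  \<open>c *\<^sub>R x\<close> reverses it, so one direction for positive \<open>c\<close> is
  enough.\<close>

lemma sublinearI:
  assumes add: "\<And>x y. p (x + y) \<le> p x + p y"
    and scale: "\<And>c x. 0 < c \<Longrightarrow> p (c *\<^sub>R x) \<le> c * p x"
    and zero: "p 0 = 0"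
  shows "sublinear p"
  unfolding sublinear_def
proof (intro conjI allI impI add)
  fix c :: real and x
  assume "0 \<le> c"
  show "p (c *\<^sub>R x) = c * p x"
  proof (cases "c = 0")
    case False
    with \<open>0 \<le> c\<close> have "0 < c" by simp
    with scale[of "inverse c" "c *\<^sub>R x"] have "c * p x \<le> p (c *\<^sub>R x)"
      by (simp add: field_simps)
    with scale[OF \<open>0 < c\<close>, of x] show ?thesis by simp
  qed (simp add: zero)
qed

text \<open>A descent step towards additivity: a minimal \<open>q\<close> must equal this
  \<open>r\<close>, and then \<open>q x + q v \<le> q (x + v)\<close>. The witness is an infimum
  over \<open>t \<ge> 0\<close>; taking \<open>t = 0\<close> and \<open>t = 1\<close> gives the two
  upper bounds.\<close>

lemma sublinear_directional:
  assumes q: "sublinear q"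
  obtains r where "sublinear r" "r \<le> q" "\<And>x. r x \<le> q (x + v) - q v"
proof
  define r where "r x = (INF t\<in>{0..}. q (x + t *\<^sub>R v) - t * q v)" for x
  \<comment> \<open>A lower bound free of \<open>t\<close> makes the real infimum
    meaningful.\<close>
  have bound: "- q (- x) \<le> q (x + t *\<^sub>R v) - t * q v" if "t \<ge> 0" for x t
    using sublinear_add[OF q, of "x + t *\<^sub>R v" "- x"] sublinear_scaleR[OF q that] by simp
  have le: "r x \<le> q (x + t *\<^sub>R v) - t * q v" if "t \<ge> 0" for x t
    unfolding r_def using that
    by (intro cINF_lower bdd_belowI2[where m = "- q (- x)"] bound) auto
  have ge: "c \<le> r x" if "\<And>t. t \<ge> 0 \<Longrightarrow> c \<le> q (x + t *\<^sub>R v) - t * q v" for c x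
    unfolding r_def using that by (intro cINF_greatest) auto
  show "r \<le> q" by (rule le_funI) (use le[of 0] in simp)
  show "r x \<le> q (x + v) - q v" for x using le[of 1 x] by simp
  show "sublinear r"
  proof (rule sublinearI)
    fix x y
    \<comment> \<open>Parameters \<open>s\<close> for \<open>x\<close> and \<open>t\<close> for
      \<open>y\<close> are matched by \<open>s + t\<close> for \<open>x + y\<close>.\<close>
    have "r (x + y) - (q (y + t *\<^sub>R v) - t * q v) \<le> r x" if "t \<ge> 0" for t
    proof (rule ge)
      fix s :: real assume "s \<ge> 0"
      have "(x + y) + (s + t) *\<^sub>R v = (x + s *\<^sub>R v) + (y + t *\<^sub>R v)"
        by (simp add: algebra_simps)
      then have "q ((x + y) + (s + t) *\<^sub>R v) \<le> q (x + s *\<^sub>R v) + q (y + t *\<^sub>R v)"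
        using sublinear_add[OF q] by metis
      with le[of "s + t" "x + y"] \<open>s \<ge> 0\<close> \<open>t \<ge> 0\<close>
      show "r (x + y) - (q (y + t *\<^sub>R v) - t * q v) \<le> q (x + s *\<^sub>R v) - s * q v"
        by (simp add: distrib_right)
    qed
    then have "r (x + y) - r x \<le> r y" by (intro ge) (simp add: algebra_simps)
    then show "r (x + y) \<le> r x + r y" by simp
  next
    fix c :: real and x assume c: "0 < c"
    have "r (c *\<^sub>R x) / c \<le> r x"
    proof (rule ge)
      fix t :: real assume "t \<ge> 0"
      have "c *\<^sub>R x + (c * t) *\<^sub>R v = c *\<^sub>R (x + t *\<^sub>R v)" by (simp add: scaleR_add_right)
      then have "q (c *\<^sub>R x + (c * t) *\<^sub>R v) = c * q (x + t *\<^sub>R v)"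
        using sublinear_scaleR[OF q, of c] c by simp
      with le[of "c * t" "c *\<^sub>R x"] c \<open>t \<ge> 0\<close>
      show "r (c *\<^sub>R x) / c \<le> q (x + t *\<^sub>R v) - t * q v" by (simp add: field_simps)
    qed
    then show "r (c *\<^sub>R x) \<le> c * r x" using c by (simp add: field_simps)
  next
    have "r 0 \<le> 0" using le[of 0 0] by (simp add: sublinear_zero[OF q])
    moreover have "0 \<le> r 0" by (rule ge) (simp add: sublinear_scaleR[OF q])
    ultimately show "r 0 = 0" by simp
  qed
qed

text \<open>The bound is the pointwise infimum, kept finite by \<open>- p (- x)\<close>.
  Subadditivity uses the chain: the functionals evaluated at \<open>x\<close> and at
  \<open>y\<close> lie above a common member of \<open>C\<close>.\<close>

lemma sublinear_chain_lower_bound: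
  assumes p: "sublinear p" and ne: "C \<noteq> {}"
    and C: "\<And>q. q \<in> C \<Longrightarrow> sublinear q \<and> q \<le> p"
    and chain: "\<And>q r. q \<in> C \<Longrightarrow> r \<in> C \<Longrightarrow> q \<le> r \<or> r \<le> q"
  obtains u where "sublinear u" "\<And>q. q \<in> C \<Longrightarrow> u \<le> q"
proof
  define u where "u x = (INF q\<in>C. q x)" for x
  have bound: "- p (- x) \<le> q x" if "q \<in> C" for q x
    using sublinear_lower[of q x] C[OF that] le_funD[of q p "- x"] by force
  have le: "u x \<le> q x" if "q \<in> C" for q x
    unfolding u_def using that by (intro cINF_lower bdd_belowI2[OF bound])
  have ge: "c \<le> u x" if "\<And>q. q \<in> C \<Longrightarrow> c \<le> q x" for c x
    unfolding u_def using that by (intro cINF_greatest ne)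
  show "u \<le> q" if "q \<in> C" for q using le[OF that] by (rule le_funI)
  show "sublinear u"
  proof (rule sublinearI)
    fix x y
    have "u (x + y) - r y \<le> u x" if r: "r \<in> C" for r
    proof (rule ge)
      fix q assume q: "q \<in> C"
      obtain s where "s \<in> C" "s \<le> q" "s \<le> r" using chain[OF q r] q r by auto
      then show "u (x + y) - r y \<le> q x"
        using le[of s "x + y"] sublinear_add[of s x y] C[of s] le_funD[of s q x] le_funD[of s r y]
        by force
    qed
    then have "u (x + y) - u x \<le> u y" by (intro ge) (simp add: algebra_simps)
    then show "u (x + y) \<le> u x + u y" by simp
  next
    fix c :: real and x assume c: "0 < c"
    have "u (c *\<^sub>R x) / c \<le> u x"
      using le[of _ "c *\<^sub>R x"] sublinear_scaleR[of _ c x] C c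
      by (intro ge) (simp add: field_simps)
    then show "u (c *\<^sub>R x) \<le> c * u x" using c by (simp add: field_simps)
  next
    have z: "q 0 = 0" if "q \<in> C" for q using C[OF that] sublinear_zero by blast
    have "0 \<le> u 0" by (rule ge) (simp add: z)
    moreover obtain q where "q \<in> C" using ne by auto
    ultimately show "u 0 = 0" using le[of q 0] z[of q] by simp
  qed
qed

text \<open>Hahn--Banach, by minimality: a minimal sublinear functional coincides with its directional
  modification along every vector, hence is additive.\<close>

theorem Hahn_Banach_sublinear:
  assumes p: "sublinear p"
  obtains l where "linear l" "\<And>x. l x \<le> p x" "l v = p v"
proof -
  \<comment> \<open>Minimising below this \<open>r\<close> instead of \<open>p\<close> fixes the
    value at \<open>v\<close>: at \<open>- v\<close> the last bound reads
    \<open>r (- v) \<le> - p v\<close>.\<close>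
  obtain r where r: "sublinear r" "r \<le> p" "\<And>x. r x \<le> p (x + v) - p v"
    using sublinear_directional[OF p] by metis
  define S where "S = {q. sublinear q \<and> q \<le> r}"
  \<comment> \<open>Zorn's lemma yields a maximal element, so it is applied to the reversed
    order.\<close>
  have "\<exists>l\<in>S. \<forall>q\<in>S. q \<le> l \<longrightarrow> q = l"
  proof (rule predicate_Zorn)
    show "partial_order_on S (relation_of (\<lambda>f g. g \<le> f) S)"
      by (auto simp: partial_order_on_def preorder_on_def refl_on_def relation_of_def
          intro!: transI antisymI)
  next
    fix C assume "C \<in> Chains (relation_of (\<lambda>f g. g \<le> f) S)"
    then have C: "\<And>q. q \<in> C \<Longrightarrow> sublinear q \<and> q \<le> r"
      and chain: "\<And>q s. q \<in> C \<Longrightarrow> s \<in> C \<Longrightarrow> q \<le> s \<or> s \<le> q"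
      by (auto simp: Chains_def relation_of_def S_def)
    show "\<exists>u\<in>S. \<forall>q\<in>C. u \<le> q"
    proof (cases "C = {}")
      case True
      then show ?thesis using r(1) by (auto simp: S_def)
    next
      case False
      then obtain u where u: "sublinear u" "\<And>q. q \<in> C \<Longrightarrow> u \<le> q"
        using sublinear_chain_lower_bound[OF r(1) _ C chain] by metis
      with False C have "u \<le> r" by (metis all_not_in_conv order_trans)
      with u show ?thesis by (auto simp: S_def)
    qed
  qed
  then obtain l where l: "sublinear l" "l \<le> r" and min: "\<And>q. sublinear q \<Longrightarrow> q \<le> l \<Longrightarrow> q = l"
    unfolding S_def by (blast intro: order_trans)
  have add: "l (x + y) = l x + l y" for x y
  proof -
    obtain s where s: "sublinear s" "s \<le> l" "\<And>x. s x \<le> l (x + y) - l y"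
      using sublinear_directional[OF l(1)] by metis
    with min have "l x \<le> l (x + y) - l y" by metis
    with sublinear_add[OF l(1), of x y] show ?thesis by simp
  qed
  have neg: "l (- x) = - l x" for x
    using add[of x "- x"] sublinear_zero[OF l(1)] by simp
  have "linear l"
  proof (rule linearI)
    show "l (c *\<^sub>R x) = c *\<^sub>R l x" for c x
    proof (cases "c \<ge> 0")
      case False
      then have "l ((- c) *\<^sub>R x) = - c * l x" by (intro sublinear_scaleR l) simp
      then show ?thesis by (simp add: neg)
    qed (simp add: sublinear_scaleR[OF l(1)])
  qed (rule add)
  moreover have "l x \<le> p x" for x
    using l(2) r(2) by (meson le_funD order_trans)
  moreover have "l v = p v"
  proof -
    have "l (- v) \<le> - p v"
      using le_funD[OF l(2), of "- v"] r(3)[of "- v"] sublinear_zero[OF p] by simp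
    with calculation(2)[of v] show ?thesis by (simp add: neg)
  qed
  ultimately show ?thesis by (rule that)
qed

section \<open>Bounded functionals from sublinear majorants\<close>

text \<open>Domination at both \<open>x\<close> and \<open>- x\<close> bounds
  \<open>\<bar>l x\<bar>\<close> by \<open>norm x\<close>, which makes the Hahn--Banach functional
  bounded.\<close>

lemma bounded_functional_below_sublinear:
  fixes p :: "'a::real_normed_vector \<Rightarrow> real"
  assumes "sublinear p" and "\<And>x. p x \<le> norm x"
  obtains f :: "'a \<Rightarrow>\<^sub>L real" where "norm f \<le> 1" "\<And>x. f x \<le> p x" "f v = p v"
proof -
  obtain l where l: "linear l" "\<And>x. l x \<le> p x" "l v = p v"
    using Hahn_Banach_sublinear[OF assms(1)] by metis
  have abs: "\<bar>l x\<bar> \<le> norm x" for x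
    using l(2)[of x] l(2)[of "- x"] assms(2)[of x] assms(2)[of "- x"] linear_neg[OF l(1), of x]
    by simp
  then have "bounded_linear l"
    by (intro bounded_linear_intro[where K = 1]) (auto simp: linear_add[OF l(1)] linear_cmul[OF l(1)])
  then have *: "blinfun_apply (Blinfun l) = l" by (rule bounded_linear_Blinfun_apply)
  show thesis
    by (rule that[of "Blinfun l"]) (use l abs in \<open>auto simp: * intro!: norm_blinfun_bound\<close>)
qed

lemma norming_functional:
  fixes x :: "'a::real_normed_vector"
  obtains f :: "'a \<Rightarrow>\<^sub>L real" where "norm f \<le> 1" "f x = norm x"
proof -
  have "sublinear (norm :: 'a \<Rightarrow> real)"
    by (rule sublinearI) (auto simp: norm_triangle_ineq)
  then show thesis
    using bounded_functional_below_sublinear[of norm x] that by (metis order_refl)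
qed

text \<open>This is the majorant from which Hahn--Banach produces functionals vanishing on a
  subspace. Approximating points of \<open>M\<close> may be added and scaled within
  \<open>M\<close>.\<close>

lemma sublinear_infdist:
  fixes M :: "'a::real_normed_vector set"
  assumes "subspace M"
  shows "sublinear (\<lambda>x. infdist x M)"
proof -
  have ne: "M \<noteq> {}" using subspace_0[OF assms] by auto
  have ge: "c \<le> infdist x M" if "\<And>m. m \<in> M \<Longrightarrow> c \<le> dist x m" for c x
    unfolding infdist_notempty[OF ne] using that ne by (intro cINF_greatest) auto
  show ?thesis
  proof (rule sublinearI)
    fix x y
    have "infdist (x + y) M - dist y n \<le> infdist x M" if "n \<in> M" for n
    proof (rule ge)
      fix m assume "m \<in> M"
      then have "infdist (x + y) M \<le> dist (x + y) (m + n)"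
        using assms that by (intro infdist_le subspace_add)
      also have "\<dots> \<le> dist x m + dist y n" by (rule dist_triangle_add)
      finally show "infdist (x + y) M - dist y n \<le> dist x m" by simp
    qed
    then have "infdist (x + y) M - infdist x M \<le> infdist y M" by (intro ge) (simp add: algebra_simps)
    then show "infdist (x + y) M \<le> infdist x M + infdist y M" by simp
  next
    fix c :: real and x assume c: "0 < c"
    have "infdist (c *\<^sub>R x) M / c \<le> infdist x M"
    proof (rule ge)
      fix m assume "m \<in> M"
      then have "infdist (c *\<^sub>R x) M \<le> dist (c *\<^sub>R x) (c *\<^sub>R m)"
        using assms by (intro infdist_le subspace_scale)
      also have "\<dots> = c * dist x m"
        using c by (simp add: dist_norm flip: scaleR_diff_right)
      finally show "infdist (c *\<^sub>R x) M / c \<le> dist x m" using c by (simp add: field_simps)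
    qed
    then show "infdist (c *\<^sub>R x) M \<le> c * infdist x M" using c by (simp add: field_simps)
  qed (simp add: subspace_0[OF assms])
qed

text \<open>A functional below the distance to \<open>M\<close> is at most 0 at \<open>m\<close> and
  at \<open>- m\<close>, hence zero on \<open>M\<close>; at \<open>v\<close> it attains the
  distance, which is nonzero off the closure.\<close>

lemma annihilating_functional:
  fixes M :: "'a::real_normed_vector set"
  assumes M: "subspace M" and v: "v \<notin> closure M"
  obtains f :: "'a \<Rightarrow>\<^sub>L real" where "f \<noteq> 0" "\<And>m. m \<in> M \<Longrightarrow> f m = 0"
proof -
  have 0: "0 \<in> M" by (rule subspace_0[OF M])
  have "infdist x M \<le> norm x" for x using infdist_le[OF 0, of x] by simp
  then obtain f :: "'a \<Rightarrow>\<^sub>L real" where f: "\<And>x. f x \<le> infdist x M" "f v = infdist v M"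
    using bounded_functional_below_sublinear[OF sublinear_infdist[OF M]] by metis
  have "f v \<noteq> 0" using f(2) v 0 in_closure_iff_infdist_zero[of M v] by auto
  then have "f \<noteq> 0" by auto
  moreover have "f m = 0" if "m \<in> M" for m
    using f(1)[of m] f(1)[of "- m"] that subspace_neg[OF M that] by (simp add: blinfun.minus_right)
  ultimately show thesis by (rule that)
qed

section \<open>Separable duals\<close>

lemma separable_euclideanE:
  assumes "separable_space (euclidean :: 'a::topological_space topology)"
  obtains D :: "'a::topological_space set" where "countable D" "closure D = UNIV"
  using assms by (auto simp: separable_space_def)

text \<open>\<open>C\<close> consists of the finite rational combinations of \<open>Y\<close>,
  indexed by lists to obtain countability. Its closure is a real subspace, as real scalars are
  limits of rational ones, and so contains \<open>span Y\<close>.\<close>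

lemma countable_dense_in_span:
  fixes Y :: "'a::real_normed_vector set"
  assumes "countable Y"
  obtains C where "countable C" "span Y \<subseteq> closure C"
proof
  define C where
    "C = (\<lambda>xs. \<Sum>(q, y)\<leftarrow>xs. real_of_rat q *\<^sub>R y) ` lists (UNIV \<times> Y)"
  show "countable C" unfolding C_def using assms by (intro countable_image countable_lists) auto
  have zero: "0 \<in> C" unfolding C_def by (rule image_eqI[of _ _ "[]"]) auto
  have add: "x + y \<in> C" if "x \<in> C" "y \<in> C" for x y
  proof -
    from that obtain xs ys where "xs \<in> lists (UNIV \<times> Y)" "ys \<in> lists (UNIV \<times> Y)"
      "x = (\<Sum>(q, y)\<leftarrow>xs. real_of_rat q *\<^sub>R y)" "y = (\<Sum>(q, y)\<leftarrow>ys. real_of_rat q *\<^sub>R y)"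
      unfolding C_def by blast
    then show ?thesis unfolding C_def by (intro image_eqI[of _ _ "xs @ ys"]) auto
  qed
  have scale: "real_of_rat r *\<^sub>R x \<in> C" if "x \<in> C" for x r
  proof -
    from that obtain xs where xs: "xs \<in> lists (UNIV \<times> Y)"
      and x: "x = (\<Sum>(q, y)\<leftarrow>xs. real_of_rat q *\<^sub>R y)"
      unfolding C_def by blast
    have "real_of_rat r *\<^sub>R (\<Sum>(q, y)\<leftarrow>xs. real_of_rat q *\<^sub>R y) =
        (\<Sum>(q, y)\<leftarrow>map (\<lambda>(q, y). (r * q, y)) xs. real_of_rat q *\<^sub>R y)"
      by (induction xs) (auto simp: scaleR_add_right of_rat_mult)
    with xs x show ?thesis
      unfolding C_def by (intro image_eqI[of _ _ "map (\<lambda>(q, y). (r * q, y)) xs"]) auto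
  qed
  have "subspace (closure C)"
  proof (rule subspaceI)
    show "0 \<in> closure C" using zero closure_subset by auto
    show "x + y \<in> closure C" if xy: "x \<in> closure C" "y \<in> closure C" for x y
    proof -
      obtain f g where "\<And>n. f n \<in> C" "f \<longlonglongrightarrow> x" "\<And>n. g n \<in> C" "g \<longlonglongrightarrow> y"
        using xy unfolding closure_sequential by blast
      then show ?thesis
        unfolding closure_sequential by (intro exI[of _ "\<lambda>n. f n + g n"]) (auto intro: add tendsto_add)
    qed
    show "c *\<^sub>R x \<in> closure C" if x: "x \<in> closure C" for c x
    proof -
      obtain f where f: "\<And>n. f n \<in> C" "f \<longlonglongrightarrow> x"
        using x unfolding closure_sequential by blast
      have "c \<in> closure \<rat>" by (simp add: Rats_closure_real)
      then obtain d where d: "\<And>n. d n \<in> \<rat>" "d \<longlonglongrightarrow> c"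
        unfolding closure_sequential by blast
      have "d n *\<^sub>R f n \<in> C" for n
        using d(1)[of n] scale[OF f(1)] by (auto elim!: Rats_cases)
      then show ?thesis
        unfolding closure_sequential using tendsto_scaleR[OF d(2) f(2)]
        by (intro exI[of _ "\<lambda>n. d n *\<^sub>R f n"]) simp
    qed
  qed
  moreover have "Y \<subseteq> closure C"
  proof
    fix y assume "y \<in> Y"
    then have "y \<in> C" unfolding C_def by (intro image_eqI[of _ _ "[(1, y)]"]) auto
    then show "y \<in> closure C" using closure_subset by auto
  qed
  ultimately show "span Y \<subseteq> closure C" by (rule span_minimal[rotated])
qed

text \<open>The norm of \<open>f\<close> need not be attained on the unit ball; the factor 2 leaves
  room, since \<open>norm f / 2\<close> is not an operator bound for nonzero
  \<open>f\<close>.\<close>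

lemma almost_norming_vector:
  fixes f :: "'a::real_normed_vector \<Rightarrow>\<^sub>L real"
  obtains x where "norm x \<le> 1" "norm f \<le> 2 * \<bar>f x\<bar>"
proof (cases "f = 0")
  case False
  then have "\<not> norm f \<le> norm f / 2" by simp
  then obtain x where x: "norm f / 2 * norm x < \<bar>f x\<bar>"
    using norm_blinfun_bound[of "norm f / 2" f] by (metis half_gt_zero_iff less_eq_real_def norm_ge_zero not_le real_norm_def zero_le_divide_iff zero_le_numeral)
  then have "x \<noteq> 0" by auto
  show thesis
    by (rule that[of "inverse (norm x) *\<^sub>R x"])
      (use x \<open>x \<noteq> 0\<close> in \<open>auto simp: blinfun.scaleR_right field_simps\<close>)
qed (use that[of 0] in simp)

text \<open>Almost norming vectors for a dense set of functionals span a dense subspace: a nonzero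
  \<open>l\<close> vanishing on all of them would be close to some \<open>f\<close> in
  \<open>D\<close>, yet \<open>f\<close> is almost normed at a vector where \<open>l\<close> is
  zero.\<close>

lemma separable_if_separable_dual:
  assumes "separable_space (euclidean :: ('a::real_normed_vector \<Rightarrow>\<^sub>L real) topology)"
  shows "separable_space (euclidean :: 'a::real_normed_vector topology)"
proof -
  obtain D :: "('a \<Rightarrow>\<^sub>L real) set" where D: "countable D" "closure D = UNIV"
    using separable_euclideanE[OF assms] by metis
  obtain y :: "('a \<Rightarrow>\<^sub>L real) \<Rightarrow> 'a" where y: "\<And>f. norm (y f) \<le> 1" "\<And>f. norm f \<le> 2 * \<bar>f (y f)\<bar>"
    using almost_norming_vector by metis
  have "closure (span (y ` D)) = UNIV"
  proof (rule ccontr)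
    assume "closure (span (y ` D)) \<noteq> UNIV"
    then obtain v where "v \<notin> closure (span (y ` D))" by auto
    then obtain l :: "'a \<Rightarrow>\<^sub>L real" where l: "l \<noteq> 0" "\<And>m. m \<in> span (y ` D) \<Longrightarrow> l m = 0"
      using annihilating_functional[OF subspace_span] by metis
    \<comment> \<open>Distance below \<open>norm l / 4\<close> forces
      \<open>norm f < norm l / 2\<close>, and the triangle inequality then gives
      \<open>norm l < 3 / 4 * norm l\<close>.\<close>
    have "l \<in> closure D" "0 < norm l / 4" using D l(1) by auto
    then obtain f where f: "f \<in> D" "dist f l < norm l / 4"
      unfolding closure_approachable by blast
    have "\<bar>f (y f)\<bar> = norm ((f - l) (y f))"
      using l(2)[OF span_base, of "y f"] f(1) by (simp add: blinfun.diff_left)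
    also have "\<dots> \<le> norm (f - l) * norm (y f)" by (rule norm_blinfun)
    also have "\<dots> \<le> norm (f - l)" using y(1) by (simp add: mult_left_le)
    finally have "norm f < norm l / 2" using f(2) y(2)[of f] by (simp add: dist_norm)
    moreover have "norm l \<le> norm f + norm (f - l)" by (metis norm_minus_commute norm_triangle_sub)
    ultimately show False using f(2) norm_ge_zero[of l] by (simp add: dist_norm)
  qed
  moreover obtain C where "countable C" "span (y ` D) \<subseteq> closure C"
    using countable_dense_in_span D(1) by (metis countable_image)
  ultimately have "closure C = UNIV" by (metis closure_closure closure_mono top.extremum_uniqueI)
  with \<open>countable C\<close> show ?thesis by (auto simp: separable_space_def)
qed

section \<open>Baire category and norm convergence of series of functionals\<close>

text \<open>Baire's theorem on the Cantor space, with index sets as predicates: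
  \<open>closed\<close> makes the complement of each \<open>P k\<close> open, and having interior
  means containing a cylinder.\<close>

lemma Baire_nat_subsets:
  fixes P :: "nat \<Rightarrow> (nat \<Rightarrow> bool) \<Rightarrow> bool"
  assumes cover: "\<And>A. \<exists>k. P k A"
    and closed: "\<And>k A. \<not> P k A \<Longrightarrow> \<exists>N. \<forall>A'. (\<forall>n<N. A' n = A n) \<longrightarrow> \<not> P k A'"
  shows "\<exists>k A N. \<forall>A'. (\<forall>n<N. A' n = A n) \<longrightarrow> P k A'"
proof -
  define X :: "(nat \<Rightarrow> bool) topology" where "X = product_topology (\<lambda>_. discrete_topology UNIV) UNIV"
  have top: "topspace X = UNIV" by (simp add: X_def)
  have cyl: "openin X {A'. \<forall>n<N. A' n = A n}" for A :: "nat \<Rightarrow> bool" and N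
  proof -
    have "{A'. \<forall>n<N. A' n = A n} = Pi\<^sub>E UNIV (\<lambda>n. if n < N then {A n} else UNIV)"
      by (auto simp: PiE_iff split: if_splits)
    moreover have "finite {n. (if n < N then {A n} else UNIV) \<noteq> UNIV}"
      by (rule finite_subset[of _ "{..<N}"]) auto
    ultimately show ?thesis
      unfolding X_def by (auto simp: openin_PiE_gen)
  qed
  have cl: "closedin X {A. P k A}" for k
  proof -
    have "openin X {A. \<not> P k A}"
    proof (subst openin_subopen, intro ballI)
      fix A assume "A \<in> {A. \<not> P k A}"
      then obtain N where "\<forall>A'. (\<forall>n<N. A' n = A n) \<longrightarrow> \<not> P k A'" using closed by blast
      then show "\<exists>T. openin X T \<and> A \<in> T \<and> T \<subseteq> {A. \<not> P k A}"
        by (intro exI[of _ "{A'. \<forall>n<N. A' n = A n}"]) (auto simp: cyl)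
    qed
    moreover have "{A. \<not> P k A} = topspace X - {A. P k A}" by (auto simp: top)
    ultimately show ?thesis by (simp add: closedin_def top)
  qed
  have "\<exists>k. X interior_of {A. P k A} \<noteq> {}"
  proof (rule ccontr)
    assume "\<not> ?thesis"
    then have "X interior_of \<Union>(range (\<lambda>k. {A. P k A})) = {}"
    proof (intro Baire_category_alt)
      show "completely_metrizable_space X \<or> locally_compact_space X \<and> regular_space X"
        unfolding X_def
        by (simp add: completely_metrizable_space_product_topology
            completely_metrizable_space_discrete_topology)
    qed (auto simp: cl)
    moreover have "\<Union>(range (\<lambda>k. {A. P k A})) = topspace X" using cover by (auto simp: top)
    ultimately show False using interior_of_topspace[of X] top by simp
  qed
  then obtain k A where A: "A \<in> X interior_of {A. P k A}" by blast
  then obtain U where U: "finite {i. U i \<noteq> UNIV}" "A \<in> Pi\<^sub>E UNIV U"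
      "Pi\<^sub>E UNIV U \<subseteq> X interior_of {A. P k A}"
    using openin_interior_of[of X "{A. P k A}"]
    unfolding X_def openin_product_topology_alt by fastforce
  \<comment> \<open>The basic open set constrains only finitely many coordinates, all of them below
    \<open>N\<close>.\<close>
  then obtain N where N: "{i. U i \<noteq> UNIV} \<subseteq> {..<N}" using finite_nat_iff_bounded by blast
  show ?thesis
  proof (intro exI allI impI)
    fix A' assume "\<forall>n<N. A' n = A n"
    then have "A' i \<in> U i" for i
      using U(2) N by (cases "U i = UNIV") (auto simp: PiE_iff)
    then have "A' \<in> Pi\<^sub>E UNIV U" by auto
    then show "P k A'" using U(3) interior_of_subset by fastforce
  qed
qed

text \<open>Every subset \<open>A\<close> of the indices has a pointwise sum \<open>S A\<close> in the dual. Norm balls are closed under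
  pointwise limits, so by Baire and separability some cylinder is mapped by \<open>S\<close> into a small ball,
  and this bounds all block sums beyond the length of the cylinder.\<close>

lemma summable_of_separable_dual:
  fixes f :: "nat \<Rightarrow> 'a::real_normed_vector \<Rightarrow>\<^sub>L 'b::banach"
  assumes sep: "separable_space (euclidean :: ('a \<Rightarrow>\<^sub>L 'b) topology)"
    and sm: "\<And>x. summable (\<lambda>n. norm (f n x))"
    and bound: "\<And>x. (\<Sum>n. norm (f n x)) \<le> K * norm x"
  shows "summable f"
  unfolding summable_Cauchy
proof (intro allI impI)
  fix e :: real assume e: "0 < e"
  obtain D :: "('a \<Rightarrow>\<^sub>L 'b) set" where D: "countable D" "closure D = UNIV"
    using separable_euclideanE[OF sep] by metis
  then have Dne: "D \<noteq> {}" by auto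
  define d where "d = from_nat_into D"
  define s where "s A x n = (if A n then f n x else 0)" for A x n
  define S where "S A x = suminf (s A x)" for A x
  have s_le: "norm (s A x n) \<le> norm (f n x)" for A x n by (simp add: s_def)
  have s_summable: "summable (s A x)" for A x
    by (rule summable_comparison_test'[OF sm[of x]]) (rule s_le)
  have S_bounded: "bounded_linear (S A)" for A
  proof (rule bounded_linear_intro)
    show "S A (x + y) = S A x + S A y" for x y
      unfolding S_def suminf_add[OF s_summable s_summable]
      by (rule suminf_cong) (simp add: s_def blinfun.add_right)
    show "S A (r *\<^sub>R x) = r *\<^sub>R S A x" for r x
      unfolding S_def suminf_scaleR_right[OF s_summable]
      by (rule suminf_cong) (simp add: s_def blinfun.scaleR_right)
    show "norm (S A x) \<le> norm x * K" for x
    proof -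
      have "norm (S A x) \<le> (\<Sum>n. norm (f n x))"
        unfolding S_def by (intro norm_suminf_le sm s_le)
      with bound[of x] show ?thesis by (simp add: mult.commute)
    qed
  qed
  \<comment> \<open>This says that \<open>S A\<close> lies within \<open>e / 3\<close> of
    \<open>d k\<close>; tested one \<open>x\<close> at a time, it is a closed condition on
    \<open>A\<close>.\<close>
  define P where "P k A \<longleftrightarrow> (\<forall>x. norm (S A x - d k x) \<le> e / 3 * norm x)" for k A
  have cover: "\<exists>k. P k A" for A
  proof -
    have SA: "blinfun_apply (Blinfun (S A)) = S A"
      by (rule bounded_linear_Blinfun_apply[OF S_bounded])
    have "Blinfun (S A) \<in> closure D" using D by simp
    then obtain g where g: "g \<in> D" "dist g (Blinfun (S A)) < e / 3"
      unfolding closure_approachable using e by (meson divide_pos_pos zero_less_numeral)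
    then obtain k where k: "g = d k"
      using from_nat_into_surj[OF D(1)] unfolding d_def by metis
    have "norm (S A x - g x) \<le> e / 3 * norm x" for x
    proof -
      have "norm (S A x - g x) \<le> norm (Blinfun (S A) - g) * norm x"
        using norm_blinfun[of "Blinfun (S A) - g" x] by (simp add: blinfun.diff_left SA)
      also have "\<dots> \<le> e / 3 * norm x"
        using g(2) by (intro mult_right_mono) (auto simp: dist_norm norm_minus_commute)
      finally show ?thesis .
    qed
    then show ?thesis unfolding P_def k by blast
  qed
  \<comment> \<open>A violation at some \<open>x\<close> is strict, and agreement below
    \<open>N\<close> changes \<open>S A x\<close> by at most the tail of the series of
    \<open>norm (f n x)\<close>, chosen smaller than the slack.\<close>
  have closed: "\<exists>N. \<forall>A'. (\<forall>n<N. A' n = A n) \<longrightarrow> \<not> P k A'" if nP: "\<not> P k A" for k A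
  proof -
    obtain x where x: "e / 3 * norm x < norm (S A x - d k x)"
      using nP unfolding P_def not_all not_le by blast
    then obtain N where "norm (\<Sum>n. norm (f (n + N) x)) < norm (S A x - d k x) - e / 3 * norm x"
      using suminf_exist_split[OF _ sm[of x]] by (metis diff_gt_0_iff_gt order_refl)
    then have N: "(\<Sum>n. norm (f (n + N) x)) < norm (S A x - d k x) - e / 3 * norm x"
      by simp
    have "\<not> P k A'" if "\<forall>n<N. A' n = A n" for A'
    proof -
      define g where "g n = s A x n - s A' x n" for n
      have g: "g sums (S A x - S A' x)"
        unfolding g_def S_def by (intro sums_diff summable_sums s_summable)
      have "(\<Sum>n<N. g n) = 0" by (rule sum.neutral) (use that in \<open>simp add: g_def s_def\<close>)
      with suminf_split_initial_segment[OF sums_summable[OF g], of N] sums_unique[OF g]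
      have "S A x - S A' x = (\<Sum>n. g (n + N))" by simp
      also have "norm \<dots> \<le> (\<Sum>n. norm (f (n + N) x))"
      proof (rule norm_suminf_le)
        show "summable (\<lambda>n. norm (f (n + N) x))" using sm by (subst summable_iff_shift)
      qed (simp add: g_def s_def)
      finally have "e / 3 * norm x < norm (S A' x - d k x)"
        using N norm_triangle_ineq[of "S A x - S A' x" "S A' x - d k x"] by simp
      then show ?thesis unfolding P_def not_all not_le by blast
    qed
    then show ?thesis by blast
  qed
  have "\<exists>k A N. \<forall>A'. (\<forall>n<N. A' n = A n) \<longrightarrow> P k A'"
    by (rule Baire_nat_subsets) (fact cover, fact closed)
  then obtain k A N where kAN: "\<forall>A'. (\<forall>n<N. A' n = A n) \<longrightarrow> P k A'"
    by (elim exE)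
  have "norm (sum f {m..<n}) < e" if "m \<ge> N" for m n
  proof -
    \<comment> \<open>Both sets agree with \<open>A\<close> below \<open>N\<close> and differ
      exactly in the block, so the block sum is \<open>S A2 - S A1\<close>, of norm at most
      \<open>2 * e / 3\<close> since both lie within \<open>e / 3\<close> of
      \<open>d k\<close>.\<close>
    define A1 where "A1 i \<longleftrightarrow> i < N \<and> A i" for i
    define A2 where "A2 i \<longleftrightarrow> i < N \<and> A i \<or> i \<in> {m..<n}" for i
    have P: "P k A1" "P k A2" using that by (auto intro!: kAN[rule_format] simp: A1_def A2_def)
    have "norm (sum f {m..<n}) \<le> 2 * e / 3"
    proof (rule norm_blinfun_bound)
      fix x
      have "(\<lambda>i. s A2 x i - s A1 x i) = (\<lambda>i. if i \<in> {m..<n} then f i x else 0)"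
        using that by (auto simp: s_def A1_def A2_def)
      then have "(\<lambda>i. s A2 x i - s A1 x i) sums (\<Sum>i\<in>{m..<n}. f i x)"
        using sums_If_finite_set[of "{m..<n}" "\<lambda>i. f i x"] by simp
      moreover have "(\<lambda>i. s A2 x i - s A1 x i) sums (S A2 x - S A1 x)"
        unfolding S_def by (intro sums_diff summable_sums s_summable)
      ultimately have "sum f {m..<n} x = (S A2 x - d k x) - (S A1 x - d k x)"
        by (simp add: blinfun.sum_left sums_unique2)
      also have "norm \<dots> \<le> e / 3 * norm x + e / 3 * norm x"
        by (rule order_trans[OF norm_triangle_ineq4 add_mono])
          (fact P[unfolded P_def, rule_format])+
      finally show "norm (sum f {m..<n} x) \<le> 2 * e / 3 * norm x" by simp
    qed (use e in simp)
    with e show ?thesis by linarith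
  qed
  then show "\<exists>N. \<forall>m\<ge>N. \<forall>n. norm (sum f {m..<n}) < e" by blast
qed

section \<open>Real spaces\<close>

text \<open>The lower bound comes from a norming functional. The isometry lets the Cauchy property
  of a series be tested in the bidual.\<close>

lemma norm_canonical_embedding: "norm (canonical_embedding x) = norm x"
proof (rule antisym)
  show "norm (canonical_embedding x) \<le> norm x"
  proof (rule norm_blinfun_bound)
    show "norm (canonical_embedding x f) \<le> norm x * norm f" for f
      using norm_blinfun[of f x] by (simp add: canonical_embedding.rep_eq mult.commute)
  qed simp
  obtain f :: "'a \<Rightarrow>\<^sub>L real" where f: "norm f \<le> 1" "f x = norm x" by (rule norming_functional)
  have "norm x \<le> norm (canonical_embedding x) * norm f"
    using norm_blinfun[of "canonical_embedding x" f] f by (simp add: canonical_embedding.rep_eq)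
  also have "\<dots> \<le> norm (canonical_embedding x)" using f by (simp add: mult_left_le)
  finally show "norm x \<le> norm (canonical_embedding x)" .
qed

lemma linear_canonical_embedding: "linear canonical_embedding"
  by (rule linearI; rule blinfun_eqI)
    (simp_all add: canonical_embedding.rep_eq blinfun.add_left blinfun.add_right
      blinfun.scaleR_left blinfun.scaleR_right)

text \<open>Testing a bidual functional \<open>\<phi>\<close> on the signed sums \<open>\<Sum>n<N. \<plusminus> y a\<^sub>n b\<^sub>n\<close>, whose norms the Bessel
  condition controls, replaces weak-star density of \<open>E\<close> in its bidual.\<close>

lemma bidual_bessel_bound:
  fixes a :: "nat \<Rightarrow> 'a::real_normed_vector" and b :: "nat \<Rightarrow> 'a \<Rightarrow>\<^sub>L real"
    and \<phi> :: "('a \<Rightarrow>\<^sub>L real) \<Rightarrow>\<^sub>L real"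
  assumes B: "0 \<le> B"
    and sm: "\<And>x y. summable (\<lambda>n. \<bar>b n x\<bar> * \<bar>blinfun_apply y (a n)\<bar>)"
    and bd: "\<And>x y. (\<Sum>n. \<bar>b n x\<bar> * \<bar>blinfun_apply y (a n)\<bar>) \<le> B * norm x * norm y"
  shows "summable (\<lambda>n. \<bar>\<phi> (b n)\<bar> * \<bar>blinfun_apply y (a n)\<bar>)"
    and "(\<Sum>n. \<bar>\<phi> (b n)\<bar> * \<bar>blinfun_apply y (a n)\<bar>) \<le> B * norm \<phi> * norm y"
proof -
  have partial: "(\<Sum>n<N. \<bar>\<phi> (b n)\<bar> * \<bar>y (a n)\<bar>) \<le> B * norm \<phi> * norm y" for N
  proof -
    define g where "g = (\<Sum>n<N. (sgn (\<phi> (b n)) * \<bar>y (a n)\<bar>) *\<^sub>R b n)"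
    have "norm g \<le> B * norm y"
    proof (rule norm_blinfun_bound)
      fix x
      have "norm (g x) \<le> (\<Sum>n<N. \<bar>b n x\<bar> * \<bar>y (a n)\<bar>)"
        unfolding g_def blinfun.sum_left blinfun.scaleR_left
        by (rule order_trans[OF norm_sum], rule sum_mono)
          (auto simp: abs_mult abs_sgn_eq)
      also have "\<dots> \<le> (\<Sum>n. \<bar>b n x\<bar> * \<bar>y (a n)\<bar>)"
        by (rule sum_le_suminf[OF sm]) auto
      also note bd
      finally show "norm (g x) \<le> B * norm y * norm x" by (simp add: mult_ac)
    qed (use B in simp)
    have "(\<Sum>n<N. \<bar>\<phi> (b n)\<bar> * \<bar>y (a n)\<bar>) = \<phi> g"
      unfolding g_def blinfun.sum_right blinfun.scaleR_right
      by (rule sum.cong) (auto simp: abs_sgn mult_ac)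
    also have "\<dots> \<le> norm \<phi> * norm g" using norm_blinfun[of \<phi> g] by simp
    also have "\<dots> \<le> norm \<phi> * (B * norm y)" by (rule mult_left_mono) (use \<open>norm g \<le> _\<close> in auto)
    finally show ?thesis by (simp add: mult_ac)
  qed
  show sm': "summable (\<lambda>n. \<bar>\<phi> (b n)\<bar> * \<bar>y (a n)\<bar>)"
    by (rule summableI_nonneg_bounded[OF _ partial]) simp
  show "(\<Sum>n. \<bar>\<phi> (b n)\<bar> * \<bar>y (a n)\<bar>) \<le> B * norm \<phi> * norm y"
    by (rule suminf_le_const[OF sm' partial])
qed

lemma besselian_frame_reflexive:
  fixes F :: "nat \<Rightarrow> 'a::banach \<times> ('a \<Rightarrow>\<^sub>L real)"
  assumes F: "besselian_schauder_frame F"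
    and sep: "separable_space (euclidean :: (('a \<Rightarrow>\<^sub>L real) \<Rightarrow>\<^sub>L real) topology)"
  shows "reflexive_space TYPE('a)"
proof -
  define a where "a n = fst (F n)" for n
  define b where "b n = snd (F n)" for n
  obtain B where B: "0 \<le> B"
    and sm: "\<And>x y. summable (\<lambda>n. \<bar>b n x\<bar> * \<bar>blinfun_apply y (a n)\<bar>)"
    and bd: "\<And>x y. (\<Sum>n. \<bar>b n x\<bar> * \<bar>blinfun_apply y (a n)\<bar>) \<le> B * norm x * norm y"
    using F unfolding besselian_schauder_frame_def a_def b_def by (meson less_imp_le)
  have frame: "(\<lambda>n. b n x *\<^sub>R a n) sums x" for x
    using F unfolding besselian_schauder_frame_def a_def b_def by blast
  have dual_expansion: "(\<lambda>n. y (a n) *\<^sub>R b n) sums y" for y :: "'a \<Rightarrow>\<^sub>L real"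
  proof -
    \<comment> \<open>The bidual is the dual of the dual, so its separability descends to the
      dual.\<close>
    have "summable (\<lambda>n. y (a n) *\<^sub>R b n)"
    proof (rule summable_of_separable_dual[OF separable_if_separable_dual[OF sep]])
      show "summable (\<lambda>n. norm ((y (a n) *\<^sub>R b n) x))" for x
        using sm[of x y] by (simp add: blinfun.scaleR_left abs_mult mult_ac)
      show "(\<Sum>n. norm ((y (a n) *\<^sub>R b n) x)) \<le> (B * norm y) * norm x" for x
        using bd[of x y] by (simp add: blinfun.scaleR_left abs_mult mult_ac)
    qed
    then obtain z where z: "(\<lambda>n. y (a n) *\<^sub>R b n) sums z" by (auto simp: summable_def)
    \<comment> \<open>The limit is identified pointwise by applying \<open>y\<close> to the frame
      expansion of \<open>x\<close>.\<close>
    have "z = y"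
    proof (rule blinfun_eqI)
      fix x
      have "(\<lambda>n. y (a n) * b n x) sums z x"
        using bounded_linear.sums[OF blinfun.bounded_linear_left z, of x]
        by (simp add: blinfun.scaleR_left)
      moreover have "(\<lambda>n. y (a n) * b n x) sums y x"
        using bounded_linear.sums[OF blinfun.bounded_linear_right frame, of y x]
        by (simp add: blinfun.scaleR_right mult.commute)
      ultimately show "z x = y x" by (rule sums_unique2)
    qed
    with z show ?thesis by simp
  qed
  have "\<exists>x. canonical_embedding x = \<phi>" for \<phi> :: "('a \<Rightarrow>\<^sub>L real) \<Rightarrow>\<^sub>L real"
  proof -
    \<comment> \<open>The series is moved into the bidual, where its terms are functionals on the
      dual and the summability criterion applies.\<close>
    have "summable (\<lambda>n. canonical_embedding (\<phi> (b n) *\<^sub>R a n))"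
    proof (rule summable_of_separable_dual[OF sep])
      show "summable (\<lambda>n. norm (canonical_embedding (\<phi> (b n) *\<^sub>R a n) y))" for y
        using bidual_bessel_bound(1)[OF B sm bd, of \<phi> y]
        by (simp add: canonical_embedding.rep_eq blinfun.scaleR_right abs_mult)
      show "(\<Sum>n. norm (canonical_embedding (\<phi> (b n) *\<^sub>R a n) y)) \<le> (B * norm \<phi>) * norm y" for y
        using bidual_bessel_bound(2)[OF B sm bd, of \<phi> y]
        by (simp add: canonical_embedding.rep_eq blinfun.scaleR_right abs_mult)
    qed
    \<comment> \<open>Isometry carries the Cauchy property back, and completeness of
      \<open>'a\<close> supplies the sum.\<close>
    then have "summable (\<lambda>n. \<phi> (b n) *\<^sub>R a n)"
      by (simp add: summable_Cauchy norm_canonical_embedding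
          flip: linear_sum[OF linear_canonical_embedding])
    then obtain z where z: "(\<lambda>n. \<phi> (b n) *\<^sub>R a n) sums z" by (auto simp: summable_def)
    have "canonical_embedding z y = \<phi> y" for y
    proof -
      \<comment> \<open>The same scalar series sums to \<open>y z\<close> and, through the dual
        expansion of \<open>y\<close>, to \<open>\<phi> y\<close>.\<close>
      have "(\<lambda>n. \<phi> (b n) * y (a n)) sums y z"
        using bounded_linear.sums[OF blinfun.bounded_linear_right z, of y]
        by (simp add: blinfun.scaleR_right)
      moreover have "(\<lambda>n. \<phi> (b n) * y (a n)) sums \<phi> y"
        using bounded_linear.sums[OF blinfun.bounded_linear_right dual_expansion, of \<phi> y]
        by (simp add: blinfun.scaleR_right mult.commute)
      ultimately show ?thesis by (simp add: canonical_embedding.rep_eq sums_unique2)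
    qed
    then show ?thesis using blinfun_eqI by blast
  qed
  then show ?thesis unfolding reflexive_space_def surj_def by metis
qed

section \<open>Complex spaces\<close>

lemma cdual_eqI: "(\<And>x. cdual_apply f x = cdual_apply g x) \<Longrightarrow> f = g"
  by transfer (rule blinfun_eqI)

lemma norm_cdual_bound: "0 \<le> K \<Longrightarrow> (\<And>x. cmod (cdual_apply f x) \<le> K * norm x) \<Longrightarrow> norm f \<le> K"
  by transfer (rule norm_blinfun_bound)

lemma norm_cdual_apply: "cmod (cdual_apply f x) \<le> norm f * norm x"
  by transfer (rule norm_blinfun)

lemma scaleC_scaleR_commute:
  "c *\<^sub>C r *\<^sub>R x = r *\<^sub>R c *\<^sub>C (x :: 'a::complex_normed_vector)"
  by (simp add: scaleC_scaleC mult.commute flip: scaleC_of_real)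

lemma bounded_linear_scaleC_right:
  "bounded_linear (\<lambda>x :: 'a::complex_normed_vector. c *\<^sub>C x)"
  by (rule bounded_linear_intro[where K = "cmod c"])
    (simp_all add: scaleC_add_right scaleC_scaleR_commute norm_scaleC mult.commute)

lemma scaleC_Re_Im:
  "c *\<^sub>C x = Re c *\<^sub>R x + Im c *\<^sub>R \<i> *\<^sub>C (x :: 'a::complex_normed_vector)"
proof -
  have "c = complex_of_real (Re c) + complex_of_real (Im c) * \<i>" by (simp add: complex_eq_iff)
  then show ?thesis by (metis scaleC_add_left scaleC_of_real scaleC_scaleC)
qed

section \<open>Correspondence between real and complex functionals\<close>

definition real_part :: "'a::complex_normed_vector cdual \<Rightarrow> 'a \<Rightarrow>\<^sub>L real" where
  "real_part f = Blinfun (\<lambda>x. Re (cdual_apply f x))"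

lemma real_part_apply: "real_part f x = Re (cdual_apply f x)"
  unfolding real_part_def
  by (subst bounded_linear_Blinfun_apply)
    (auto intro: bounded_linear_compose[OF bounded_linear_Re bounded_linear_cdual_apply])

lemma bounded_linear_real_part: "bounded_linear real_part"
proof (rule bounded_linear_intro[where K = 1])
  show "real_part (f + g) = real_part f + real_part g" for f g :: "'a cdual"
    by (rule blinfun_eqI)
      (simp add: real_part_apply blinfun.add_left
        linear_add[OF bounded_linear.linear[OF bounded_linear_cdual_eval]])
  show "real_part (r *\<^sub>R f) = r *\<^sub>R real_part f" for r and f :: "'a cdual"
    by (rule blinfun_eqI)
      (simp add: real_part_apply blinfun.scaleR_left
        linear_cmul[OF bounded_linear.linear[OF bounded_linear_cdual_eval]])
  show "norm (real_part f) \<le> norm f * 1" for f :: "'a cdual"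
    using norm_cdual_apply[of f]
    by (intro norm_blinfun_bound) (auto simp: real_part_apply intro: order_trans[OF abs_Re_le_cmod])
qed

lemma bounded_linear_complexify_apply:
  fixes y :: "'a::complex_normed_vector \<Rightarrow>\<^sub>L real"
  shows "bounded_linear (\<lambda>x. Complex (y x) (- y (\<i> *\<^sub>C x)))"
proof -
  have "bounded_linear (\<lambda>x. of_real (y x) - \<i> * of_real (y (\<i> *\<^sub>C x)))"
    by (intro bounded_linear_sub bounded_linear_compose[OF bounded_linear_mult_right]
        bounded_linear_compose[OF bounded_linear_of_real]
        bounded_linear_compose[OF blinfun.bounded_linear_right bounded_linear_scaleC_right]
        blinfun.bounded_linear_right)
  moreover have "(\<lambda>x. of_real (y x) - \<i> * of_real (y (\<i> *\<^sub>C x))) =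
      (\<lambda>x. Complex (y x) (- y (\<i> *\<^sub>C x)))"
    by (simp add: complex_eq_iff fun_eq_iff)
  ultimately show ?thesis by simp
qed

text \<open>Inverse of \<open>real_part\<close>: complex linearity forces the imaginary part at
  \<open>x\<close> to be minus the real part at \<open>\<i> *\<^sub>C x\<close>.\<close>

definition complexify :: "('a::complex_normed_vector \<Rightarrow>\<^sub>L real) \<Rightarrow> 'a cdual" where
  "complexify y = Abs_cdual (Blinfun (\<lambda>x. Complex (y x) (- y (\<i> *\<^sub>C x))))"

lemma complexify_apply: "cdual_apply (complexify y) x = Complex (y x) (- y (\<i> *\<^sub>C x))"
proof -
  let ?f = "Blinfun (\<lambda>x. Complex (y x) (- y (\<i> *\<^sub>C x)))"
  have f_apply: "?f x = Complex (y x) (- y (\<i> *\<^sub>C x))" for x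
    by (simp add: bounded_linear_Blinfun_apply bounded_linear_complexify_apply)
  \<comment> \<open>Complex linearity must be checked before \<open>Abs_cdual\<close> can be
    evaluated; \<open>\<i> *\<^sub>C c *\<^sub>C x\<close> is split into real multiples of
    \<open>x\<close> and \<open>\<i> *\<^sub>C x\<close>.\<close>
  have "?f (c *\<^sub>C x) = c * ?f x" for c x
  proof -
    have "\<i> *\<^sub>C c *\<^sub>C x = Re c *\<^sub>R \<i> *\<^sub>C x - Im c *\<^sub>R x"
      using scaleC_Re_Im[of "\<i> * c" x] by (simp add: scaleC_scaleC)
    then show ?thesis
      unfolding f_apply using scaleC_Re_Im[of c x]
      by (simp add: complex_eq_iff blinfun.add_right blinfun.diff_right blinfun.scaleR_right)
  qed
  then show ?thesis
    by (simp add: complexify_def cdual_apply.rep_eq Abs_cdual_inverse f_apply)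
qed

lemma real_part_complexify: "real_part (complexify y) = y"
  by (rule blinfun_eqI) (simp add: real_part_apply complexify_apply)

lemma complexify_real_part: "complexify (real_part f) = f"
  by (rule cdual_eqI) (simp add: complexify_apply real_part_apply cdual_apply_scaleC complex_eq_iff)

text \<open>Bounding the modulus by the absolute real and imaginary parts costs a factor 2, which
  reappears in the real frame bound.\<close>

lemma norm_complexify_le: "norm (complexify y) \<le> 2 * norm y"
proof (rule norm_cdual_bound)
  fix x
  have "cmod (cdual_apply (complexify y) x) \<le> \<bar>y x\<bar> + \<bar>y (\<i> *\<^sub>C x)\<bar>"
    using cmod_le[of "cdual_apply (complexify y) x"] by (simp add: complexify_apply)
  also have "\<dots> \<le> norm y * norm x + norm y * norm x"
    using norm_blinfun[of y x] norm_blinfun[of y "\<i> *\<^sub>C x"]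
    by (intro add_mono) (simp_all add: norm_scaleC)
  finally show "cmod (cdual_apply (complexify y) x) \<le> 2 * norm y * norm x" by (simp add: mult_ac)
qed simp

lemma bounded_linear_complexify: "bounded_linear complexify"
proof (rule bounded_linear_intro[where K = 2])
  have add: "cdual_apply (f + g) x = cdual_apply f x + cdual_apply g x" for f g :: "'a cdual" and x
    by transfer (rule blinfun.add_left)
  have scale: "cdual_apply (r *\<^sub>R f) x = r *\<^sub>R cdual_apply f x" for r and f :: "'a cdual" and x
    by transfer (rule blinfun.scaleR_left)
  show "complexify (y + z) = complexify y + complexify z" for y z :: "'a \<Rightarrow>\<^sub>L real"
    by (rule cdual_eqI) (simp add: add complexify_apply blinfun.add_left complex_eq_iff)
  show "complexify (r *\<^sub>R y) = r *\<^sub>R complexify y" for r and y :: "'a \<Rightarrow>\<^sub>L real"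
    by (rule cdual_eqI) (simp add: scale complexify_apply blinfun.scaleR_left complex_eq_iff)
  show "norm (complexify y) \<le> norm y * 2" for y :: "'a \<Rightarrow>\<^sub>L real"
    using norm_complexify_le[of y] by (simp add: mult.commute)
qed

section \<open>Comparison of the complex and the real bidual\<close>

definition real_bidual ::
  "'a::complex_normed_vector cdual cdual \<Rightarrow> ('a \<Rightarrow>\<^sub>L real) \<Rightarrow>\<^sub>L real" where
  "real_bidual \<phi> = real_part \<phi> o\<^sub>L Blinfun complexify"

lemma real_bidual_apply: "real_bidual \<phi> y = Re (cdual_apply \<phi> (complexify y))"
  by (simp add: real_bidual_def real_part_apply bounded_linear_Blinfun_apply[OF bounded_linear_complexify])

lemma bounded_linear_real_bidual: "bounded_linear real_bidual"
  unfolding real_bidual_def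
  by (rule bounded_linear_compose[OF
        bounded_bilinear.bounded_linear_left[OF bounded_bilinear_blinfun_compose]
        bounded_linear_real_part])

text \<open>Through \<open>real_part\<close>, \<open>\<psi>\<close> becomes a real functional on the
  complex dual; complexifying that gives a preimage.\<close>

lemma surj_real_bidual: "surj real_bidual"
proof (rule surjI)
  fix \<psi> :: "('a \<Rightarrow>\<^sub>L real) \<Rightarrow>\<^sub>L real"
  show "real_bidual (complexify (\<psi> o\<^sub>L Blinfun real_part)) = \<psi>"
    by (rule blinfun_eqI)
      (simp add: real_bidual_apply complexify_apply real_part_complexify
        bounded_linear_Blinfun_apply[OF bounded_linear_real_part])
qed

lemma separable_real_bidual:
  assumes "separable_space (euclidean :: 'a::complex_normed_vector cdual cdual topology)"
  shows "separable_space (euclidean :: (('a::complex_normed_vector \<Rightarrow>\<^sub>L real) \<Rightarrow>\<^sub>L real) topology)"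
proof (rule separable_space_continuous_map_image[OF assms])
  show "continuous_map euclidean euclidean (real_bidual :: 'a cdual cdual \<Rightarrow> _)"
    by (simp add: linear_continuous_on bounded_linear_real_bidual)
  show "real_bidual ` topspace (euclidean :: 'a cdual cdual topology) = topspace euclidean"
    using surj_real_bidual by simp
qed

text \<open>A point representing \<open>real_bidual \<phi>\<close> matches the real parts of the
  values of \<open>\<phi>\<close> and of evaluation at \<open>x\<close> on every \<open>f\<close>;
  replacing \<open>f\<close> by \<open>\<i> *\<^sub>C f\<close> matches the imaginary parts.\<close>

lemma complex_reflexive_if_reflexive:
  assumes "reflexive_space TYPE('a::complex_normed_vector)"
  shows "complex_reflexive_space TYPE('a)"
proof -
  have "\<exists>x. complex_canonical_embedding x = \<phi>" for \<phi> :: "'a cdual cdual"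
  proof -
    obtain x where x: "canonical_embedding x = real_bidual \<phi>"
      using assms unfolding reflexive_space_def surj_def by metis
    have Re: "Re (cdual_apply \<phi> f) = Re (cdual_apply f x)" for f
      using arg_cong[OF x, of "\<lambda>\<psi>. blinfun_apply \<psi> (real_part f)"]
      by (simp add: canonical_embedding.rep_eq real_bidual_apply complexify_real_part real_part_apply)
    have "cdual_apply \<phi> f = cdual_apply f x" for f
      using Re[of f] Re[of "\<i> *\<^sub>C f"]
      by (simp add: complex_eq_iff cdual_apply_scaleC cdual_apply_scaleC_left)
    then show ?thesis
      by (metis cdual_eqI complex_canonical_embedding_apply)
  qed
  then show ?thesis unfolding complex_reflexive_space_def surj_def by metis
qed

section \<open>From a complex frame to a real frame\<close>

text \<open>Pairing consecutive terms recovers the given series; the hypothesis on \<open>u\<close>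
  controls the partial sums of odd length, which end in an unpaired term.\<close>

lemma sums_interleave:
  fixes u v :: "nat \<Rightarrow> 'a::real_normed_vector"
  assumes s: "(\<lambda>n. u n + v n) sums s" and u: "u \<longlonglongrightarrow> 0"
  shows "(\<lambda>n. if even n then u (n div 2) else v (n div 2)) sums s"
proof -
  define w where "w n = (if even n then u (n div 2) else v (n div 2))" for n
  have partial: "sum w {..<n} = (\<Sum>i<n div 2. u i + v i) + (if odd n then u (n div 2) else 0)" for n
    by (induction n) (auto simp: w_def add.assoc elim!: oddE evenE)
  have half: "filterlim (\<lambda>n::nat. n div 2) at_top at_top"
    unfolding filterlim_at_top eventually_sequentially
    by presburger
  have "(\<lambda>n. \<Sum>i<n div 2. u i + v i) \<longlonglongrightarrow> s"
    using filterlim_compose[OF _ half] s unfolding sums_def .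
  moreover have "(\<lambda>n. if odd n then u (n div 2) else 0) \<longlonglongrightarrow> 0"
    by (rule Lim_null_comparison[OF _ tendsto_norm_zero[OF filterlim_compose[OF u half]]])
      (auto intro: always_eventually)
  ultimately have "(\<lambda>n. sum w {..<n}) \<longlonglongrightarrow> s + 0" unfolding partial by (rule tendsto_add)
  then show ?thesis by (simp add: sums_def w_def)
qed

text \<open>As a real space, \<open>E\<close> inherits a frame because
  \<open>b(x) a = (Re b)(x) a + (Im b)(x) \<i>a\<close>, and \<open>Im b = Re (- \<i>b)\<close>.\<close>

lemma real_besselian_frame:
  fixes F :: "nat \<Rightarrow> 'a::complex_normed_vector \<times> 'a cdual"
  assumes F: "complex_besselian_schauder_frame F"
  obtains G :: "nat \<Rightarrow> 'a \<times> ('a \<Rightarrow>\<^sub>L real)" where "besselian_schauder_frame G"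
proof
  define a where "a n = fst (F n)" for n
  define b where "b n = snd (F n)" for n
  obtain B where B: "0 < B"
    and sm: "\<And>x y. summable (\<lambda>n. cmod (cdual_apply (b n) x) * cmod (cdual_apply y (a n)))"
    and bd: "\<And>x y. (\<Sum>n. cmod (cdual_apply (b n) x) * cmod (cdual_apply y (a n))) \<le> B * norm x * norm y"
    using F unfolding complex_besselian_schauder_frame_def a_def b_def by metis
  have frame: "(\<lambda>n. cdual_apply (b n) x *\<^sub>C a n) sums x" for x
    using F unfolding complex_besselian_schauder_frame_def a_def b_def by blast
  define G where "G n = (let k = n div 2 in
      if even n then (a k, real_part (b k)) else (\<i> *\<^sub>C a k, real_part (- \<i> *\<^sub>C b k)))" for n
  have re: "real_part (b k) x = Re (cdual_apply (b k) x)"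
    and im: "real_part (- \<i> *\<^sub>C b k) x = Im (cdual_apply (b k) x)" for k x
    by (simp_all add: real_part_apply cdual_apply_scaleC_left)
  have "(\<lambda>n. snd (G n) x *\<^sub>R fst (G n)) sums x" for x
  proof -
    let ?u = "\<lambda>n. Re (cdual_apply (b n) x) *\<^sub>R a n"
    let ?v = "\<lambda>n. Im (cdual_apply (b n) x) *\<^sub>R \<i> *\<^sub>C a n"
    have "?u n + ?v n = cdual_apply (b n) x *\<^sub>C a n" for n
      by (rule scaleC_Re_Im[symmetric])
    then have "(\<lambda>n. ?u n + ?v n) sums x" using frame by simp
    \<comment> \<open>Interleaving needs null terms: \<open>?u\<close> is dominated by the terms of
      the convergent complex expansion.\<close>
    moreover have "?u \<longlonglongrightarrow> 0"
    proof (rule Lim_null_comparison)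
      show "\<forall>\<^sub>F n in sequentially. norm (?u n) \<le> norm (cdual_apply (b n) x *\<^sub>C a n)"
        by (auto simp: norm_scaleC intro!: always_eventually mult_right_mono abs_Re_le_cmod)
      show "(\<lambda>n. norm (cdual_apply (b n) x *\<^sub>C a n)) \<longlonglongrightarrow> 0"
        using summable_LIMSEQ_zero[OF sums_summable[OF frame]] by (rule tendsto_norm_zero)
    qed
    ultimately have "(\<lambda>n. if even n then ?u (n div 2) else ?v (n div 2)) sums x"
      by (rule sums_interleave)
    also have "(\<lambda>n. if even n then ?u (n div 2) else ?v (n div 2)) =
        (\<lambda>n. snd (G n) x *\<^sub>R fst (G n))"
      by (auto simp: G_def Let_def re im)
    finally show ?thesis .
  qed
  moreover have "summable (\<lambda>n. \<bar>snd (G n) x\<bar> * \<bar>blinfun_apply y (fst (G n))\<bar>) \<and>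
      (\<Sum>n. \<bar>snd (G n) x\<bar> * \<bar>blinfun_apply y (fst (G n))\<bar>) \<le> (4 * B) * norm x * norm y" for x y
  proof -
    let ?w = "\<lambda>n. cmod (cdual_apply (b n) x) * cmod (cdual_apply (complexify y) (a n))"
    let ?u = "\<lambda>n. \<bar>Re (cdual_apply (b n) x)\<bar> * \<bar>y (a n)\<bar>"
    let ?v = "\<lambda>n. \<bar>Im (cdual_apply (b n) x)\<bar> * \<bar>y (\<i> *\<^sub>C a n)\<bar>"
    \<comment> \<open>Up to sign, these are the real and imaginary parts of
      \<open>complexify y\<close> at \<open>z\<close>.\<close>
    have "\<bar>y z\<bar> \<le> cmod (cdual_apply (complexify y) z)"
      "\<bar>y (\<i> *\<^sub>C z)\<bar> \<le> cmod (cdual_apply (complexify y) z)" for z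
      using abs_Re_le_cmod[of "cdual_apply (complexify y) z"]
        abs_Im_le_cmod[of "cdual_apply (complexify y) z"]
      by (simp_all add: complexify_apply)
    then have uw: "?u n \<le> ?w n" and vw: "?v n \<le> ?w n" for n
      by (auto intro!: mult_mono abs_Re_le_cmod abs_Im_le_cmod)
    have su: "summable ?u" and sv: "summable ?v"
      by (auto intro!: summable_comparison_test'[OF sm[of x "complexify y"]] simp: uw vw)
    have "(\<lambda>n. if even n then ?u (n div 2) else ?v (n div 2)) sums (suminf ?u + suminf ?v)"
      by (intro sums_interleave sums_add summable_sums su sv summable_LIMSEQ_zero[OF su])
    also have "(\<lambda>n. if even n then ?u (n div 2) else ?v (n div 2)) =
        (\<lambda>n. \<bar>snd (G n) x\<bar> * \<bar>y (fst (G n))\<bar>)"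
      by (auto simp: G_def Let_def re im)
    finally have sums: "(\<lambda>n. \<bar>snd (G n) x\<bar> * \<bar>y (fst (G n))\<bar>) sums (suminf ?u + suminf ?v)" .
    \<comment> \<open>Origin of \<open>4 * B\<close>: two real series, each bounded by the complex
      Bessel sum for \<open>complexify y\<close>, whose norm is at most
      \<open>2 * norm y\<close>.\<close>
    have "suminf ?u + suminf ?v \<le> suminf ?w + suminf ?w"
      by (intro add_mono suminf_le uw vw su sv sm)
    also have "\<dots> \<le> 2 * (B * norm x * norm (complexify y))"
      using bd[of x "complexify y"] by simp
    also have "\<dots> \<le> 2 * (B * norm x * (2 * norm y))"
      using B by (intro mult_left_mono norm_complexify_le) auto
    finally show ?thesis using sums_summable[OF sums] sums_unique[OF sums] by (simp add: mult_ac)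
  qed
  ultimately show "besselian_schauder_frame G"
    unfolding besselian_schauder_frame_def using B by (intro conjI exI[of _ "4 * B"]) auto
qed

theorem corollary11:
  shows
    "((\<exists>F :: nat \<Rightarrow> 'a::banach \<times> ('a \<Rightarrow>\<^sub>L real). besselian_schauder_frame F) \<longrightarrow>
      separable_space (euclidean :: (('a \<Rightarrow>\<^sub>L real) \<Rightarrow>\<^sub>L real) topology) \<longrightarrow>
      reflexive_space TYPE('a)) \<and>
     ((\<exists>F :: nat \<Rightarrow> 'b::cbanach \<times> 'b cdual. complex_besselian_schauder_frame F) \<longrightarrow>
      separable_space (euclidean :: 'b cdual cdual topology) \<longrightarrow>
      complex_reflexive_space TYPE('b))"
  \<comment> \<open>The complex case passes through the underlying real space: real frame, separable
    real bidual, real reflexivity, and back.\<close>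
  by (meson besselian_frame_reflexive complex_reflexive_if_reflexive real_besselian_frame
      separable_real_bidual)

end
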